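(* For all integers $g\ge 3$ and $k\ge 1$, there exists a finite collection $\mathcal{S}$ of straight (infinite) lines in $\mathbb{R}^3$ whose intersection graph has girth at least $g$ and chromatic number at least $k$.
   Context: The intersection graph of a collection of sets is the simple graph whose vertices are the sets of the collection, two distinct sets being adjacent if and only if they have non-empty intersection. The girth of a graph is the length of its shortest cycle ($\infty$ if the graph has no cycle). *)

theory Defs
  imports "HOL-Analysis.Analysis" "HOL-Library.Extended_Nat" "Graph_Theory.Pair_Digraph"
begin

text \<open>A simple undirected graph is a \<^locale>\<open>pair_graph\<close>: each edge \<open>uv\<close> is
  represented by the two opposite arcs \<open>(u, v)\<close> and \<open>(v, u)\<close>.\<close>

definition intersection_graph :: "'a set set \<Rightarrow> 'a set pair_pre_digraph" where
  "intersection_graph \<S> =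
     \<lparr> pverts = \<S>, parcs = {(A, B). A \<in> \<S> \<and> B \<in> \<S> \<and> A \<noteq> B \<and> A \<inter> B \<noteq> {}} \<rparr>"

lemma pair_graph_intersection_graph:
  assumes "finite \<S>"
  shows "pair_graph (intersection_graph \<S>)"
proof -
  have "parcs (intersection_graph \<S>) \<subseteq> \<S> \<times> \<S>"
    by (auto simp: intersection_graph_def)
  then have "finite (parcs (intersection_graph \<S>))"
    using assms finite_subset by blast
  then show ?thesis
    using assms
    by unfold_locales (auto simp: intersection_graph_def symmetric_def intro!: symI)
qed

text \<open>The length bound excludes the closed walks \<open>u, v, u\<close> that traverse an edge back and
  forth: these are cycles of the symmetric digraph but not of the undirected graph.
  The infimum of the empty set is \<open>\<infinity>\<close>.\<close>

definition girth :: "'v pair_pre_digraph \<Rightarrow> enat" where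
  "girth G = (INF p \<in> {p. pre_digraph.cycle (with_proj G) p \<and> 3 \<le> length p}. enat (length p))"

definition proper_coloring :: "'v pair_pre_digraph \<Rightarrow> nat \<Rightarrow> ('v \<Rightarrow> nat) \<Rightarrow> bool" where
  "proper_coloring G n c \<longleftrightarrow>
     c ` pverts G \<subseteq> {..<n} \<and> (\<forall>(u, v) \<in> parcs G. c u \<noteq> c v)"

definition chromatic_number :: "'v pair_pre_digraph \<Rightarrow> enat" where
  "chromatic_number G = (INF n \<in> {n. \<exists>c. proper_coloring G n c}. enat n)"

definition is_line :: "'a::euclidean_space set \<Rightarrow> bool" where
  "is_line L \<longleftrightarrow> affine L \<and> aff_dim L = 1"

end

theory Submission
  imports Defs
begin

text \<open>The lines are projections of axis-parallel lines of the grid \<open>{..<R}\<^sup>R\<close>: a generic linear map to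
  three-space creates no new intersections. In the grid, a cycle of \<open>l\<close> lines must either
  repeat a direction or contain three lines through one point, so a proportion of only \<open>O(1 / R)\<close> of all
  walks of length \<open>l\<close> closes up to a cycle. Hence in a random sample of lines with expected degree a
  constant \<open>d\<close>, independent of \<open>R\<close>, few lines lie on short cycles. On the other hand, every set of
  a constant proportion of the lines contains a line that crosses a constant proportion of the
  maximal possible number of its members, so a counting argument in the style of Kleitman and Winston shows that the
  sample has no independent set containing a proportion \<open>1 / (2 * k)\<close> of it. Deleting the lines on short
  cycles leaves at least half of the sample, and this needs more than \<open>k\<close> colours.\<close>

section \<open>Counting families without edges\<close>

definition independent_family :: "('v \<Rightarrow> 'v \<Rightarrow> bool) \<Rightarrow> 'i set \<Rightarrow> ('i \<Rightarrow> 'v) \<Rightarrow> bool" where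
  "independent_family E J f \<longleftrightarrow> (\<forall>i\<in>J. \<forall>j\<in>J. \<not> E (f i) (f j))"

definition cycle_list :: "('v \<Rightarrow> 'v \<Rightarrow> bool) \<Rightarrow> 'v list \<Rightarrow> bool" where
  "cycle_list E xs \<longleftrightarrow> distinct xs \<and> successively E xs \<and> E (last xs) (hd xs)"

text \<open>Choose the values of \<open>f\<close> one after the other and let \<open>A\<close> be the set of vertices that are
  still available. A chosen vertex of degree at least \<open>b\<close> in \<open>A\<close> removes \<open>b\<close> vertices from \<open>A\<close>, which
  happens at most \<open>h\<close> times; all other choices lie in a set of density at most \<open>1 / K\<close>.\<close>

lemma card_independent_families:
  fixes V :: "'v set" and K b h :: nat
  assumes V: "finite V" and b: "b > 0" and K: "K > 0"
    and low: "\<And>A. A \<subseteq> V \<Longrightarrow> card {v \<in> A. card {w \<in> A. E v w} < b} * K \<le> card V"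
    and "finite J" "A \<subseteq> V" "card A \<le> h * b"
  shows "card {f \<in> J \<rightarrow>\<^sub>E A. independent_family E J f} * K ^ card J \<le> (2 * card V) ^ card J * K ^ h"
  using \<open>finite J\<close> \<open>A \<subseteq> V\<close> \<open>card A \<le> h * b\<close>
proof (induction J arbitrary: A h rule: finite_induct)
  case empty
  then show ?case using K by (auto simp: independent_family_def intro: card_mono[of "{\<lambda>x. undefined}", simplified])
next
  case (insert a J)
  define n where "n = card V"
  define s where "s = card J"
  define F where "F B = {f \<in> J \<rightarrow>\<^sub>E B. independent_family E J f}" for B
  define R where "R v = {w \<in> A. \<not> E v w}" for v
  define Lo where "Lo = {v \<in> A. card {w \<in> A. E v w} < b}"
  have finA: "finite A" using insert.prems V finite_subset by blast
  have finF: "finite (F B)" if "B \<subseteq> A" for B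
    unfolding F_def using insert.hyps finA that by (auto intro!: finite_PiE intro: finite_subset)
  have AV: "card A \<le> n" using insert.prems V by (simp add: n_def card_mono)
  \<comment> \<open>Splitting off the value \<open>v = f a\<close> leaves a family in
    \<open>R v\<close>, the non-neighbours of \<open>v\<close> in \<open>A\<close>.\<close>
  have step: "card {f \<in> insert a J \<rightarrow>\<^sub>E A. independent_family E (insert a J) f} \<le> (\<Sum>v\<in>A. card (F (R v)))"
  proof -
    let ?g = "\<lambda>f. (f a, f(a := undefined))"
    have "inj_on ?g (insert a J \<rightarrow>\<^sub>E A)"
      by (rule inj_onI) (metis Pair_inject fun_upd_triv fun_upd_upd)
    then have "inj_on ?g {f \<in> insert a J \<rightarrow>\<^sub>E A. independent_family E (insert a J) f}"
      by (rule inj_on_subset) auto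
    moreover have "?g ` {f \<in> insert a J \<rightarrow>\<^sub>E A. independent_family E (insert a J) f} \<subseteq> Sigma A (\<lambda>v. F (R v))"
      using insert.hyps by (fastforce simp: F_def R_def independent_family_def PiE_iff extensional_def)
    moreover have "finite (Sigma A (\<lambda>v. F (R v)))"
      by (intro finite_SigmaI finA finF) (auto simp: R_def)
    ultimately have "card {f \<in> insert a J \<rightarrow>\<^sub>E A. independent_family E (insert a J) f} \<le> card (Sigma A (\<lambda>v. F (R v)))"
      using card_inj_on_le by blast
    then show ?thesis using finA finF by (subst (asm) card_SigmaI) (auto simp: R_def)
  qed
  have RV: "R v \<subseteq> V" for v using insert.prems by (auto simp: R_def)
  have RA: "card (R v) \<le> card A" for v using finA by (auto simp: R_def intro!: card_mono)
  \<comment> \<open>A low-degree \<open>v\<close> leaves the budget \<open>h\<close> unchanged, but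
    there are at most \<open>n / K\<close> of them, which pays for the new factor
    \<open>K\<close>.\<close>
  have lo: "(\<Sum>v\<in>Lo. card (F (R v))) * K ^ Suc s \<le> n * (2 * n) ^ s * K ^ h"
  proof -
    have "card (F (R v)) * K ^ s \<le> (2 * n) ^ s * K ^ h" for v
      using insert.IH[OF RV[of v], of h] RA[of v] insert.prems by (simp add: F_def s_def n_def)
    then have "(\<Sum>v\<in>Lo. card (F (R v)) * K ^ s) \<le> card Lo * ((2 * n) ^ s * K ^ h)"
      using sum_bounded_above[of Lo "\<lambda>v. card (F (R v)) * K ^ s"] by simp
    then have "(\<Sum>v\<in>Lo. card (F (R v)) * K ^ s) * K \<le> card Lo * ((2 * n) ^ s * K ^ h) * K"
      using mult_le_mono1 by blast
    also have "\<dots> = (card Lo * K) * ((2 * n) ^ s * K ^ h)" by simp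
    also have "\<dots> \<le> n * ((2 * n) ^ s * K ^ h)"
      using low[OF insert.prems(1)] unfolding Lo_def n_def by (rule mult_le_mono1)
    finally show ?thesis by (simp only: sum_distrib_right[symmetric] power_Suc2 mult.assoc)
  qed
  \<comment> \<open>There may be up to \<open>n\<close> such \<open>v\<close>, but each removes at
    least \<open>b\<close> vertices: the budget drops to \<open>h - 1\<close>, and the saved factor
    \<open>K\<close> pays instead.\<close>
  have hi: "(\<Sum>v\<in>A-Lo. card (F (R v))) * K ^ Suc s \<le> n * (2 * n) ^ s * K ^ h"
  proof -
    have *: "card (F (R v)) * K ^ Suc s \<le> (2 * n) ^ s * K ^ h" if "v \<in> A - Lo" for v
    proof -
      have ge: "b \<le> card {w \<in> A. E v w}" using that by (auto simp: Lo_def)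
      have "card A = card (R v) + card {w \<in> A. E v w}"
        using finA by (subst card_Un_disjoint[symmetric]) (auto simp: R_def intro!: arg_cong[of _ _ card])
      with ge insert.prems b obtain h' where h': "h = Suc h'" "card (R v) \<le> h' * b" by (cases h) auto
      have "card (F (R v)) * K ^ s \<le> (2 * n) ^ s * K ^ h'"
        using insert.IH[OF RV[of v] h'(2)] by (simp add: F_def s_def n_def)
      then have "card (F (R v)) * K ^ s * K \<le> (2 * n) ^ s * K ^ h' * K" by (rule mult_le_mono1)
      then show ?thesis by (simp add: h' algebra_simps)
    qed
    have "(\<Sum>v\<in>A-Lo. card (F (R v)) * K ^ Suc s) \<le> card (A - Lo) * ((2 * n) ^ s * K ^ h)"
      using sum_bounded_above[of "A-Lo" "\<lambda>v. card (F (R v)) * K ^ Suc s"] * by simp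
    also have "\<dots> \<le> n * ((2 * n) ^ s * K ^ h)"
      using AV finA card_mono[of A "A-Lo"] by (intro mult_le_mono1) (auto intro: order_trans)
    finally show ?thesis by (simp only: sum_distrib_right[symmetric] mult.assoc)
  qed
  have "(\<Sum>v\<in>A. card (F (R v))) = (\<Sum>v\<in>Lo. card (F (R v))) + (\<Sum>v\<in>A-Lo. card (F (R v)))"
    using finA by (metis (no_types, lifting) Lo_def add.commute mem_Collect_eq subsetI sum.subset_diff)
  \<comment> \<open>The two cases have equal bounds; adding them produces the \<open>2\<close> in
    \<open>2 * card V\<close>.\<close>
  with lo hi have "(\<Sum>v\<in>A. card (F (R v))) * K ^ Suc s \<le> (2 * n) ^ Suc s * K ^ h"
    by (simp add: algebra_simps)
  then have "card {f \<in> insert a J \<rightarrow>\<^sub>E A. independent_family E (insert a J) f} * K ^ Suc s \<le> (2 * n) ^ Suc s * K ^ h"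
    using mult_le_mono1[OF step, of "K ^ Suc s"] by linarith
  then show ?case using insert.hyps by (simp add: s_def n_def)
qed

subsection \<open>Random samples of a graph\<close>

text \<open>A union bound over all maps from \<open>4 * k * h\<close> indices to \<open>V\<close>,
  that is, samples with repetition. At most a quarter of them have \<open>2 * h\<close> indices
  without edges between their values, and at most a quarter have more than half of their indices at
  the head of a short cycle. In any other sample at least \<open>2 * k * h\<close> indices survive,
  too many for \<open>k\<close> colour classes of fewer than \<open>2 * h\<close> indices
  each.\<close>

lemma sparse_sampling:
  fixes V :: "'v set" and E :: "'v \<Rightarrow> 'v \<Rightarrow> bool" and k b h g :: nat
  defines "K \<equiv> 2 ^ (4 * k + 4)"
  assumes V: "finite V" "V \<noteq> {}" and b: "b > 0" and h: "h > 0" and k: "k > 0" and g: "g > 0"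
    and low: "\<And>A. A \<subseteq> V \<Longrightarrow> card {v \<in> A. card {w \<in> A. E v w} < b} * K \<le> card V"
    and hb: "card V \<le> h * b"
    and cyc: "\<And>l. 3 \<le> l \<Longrightarrow> l < g \<Longrightarrow>
      8 * g * (4 * k * h) ^ l * card {xs. length xs = l \<and> set xs \<subseteq> V \<and> cycle_list E xs} \<le> 4 * k * h * card V ^ l"
  shows "\<exists>S\<subseteq>V.
    (\<forall>xs. set xs \<subseteq> S \<longrightarrow> 3 \<le> length xs \<longrightarrow> length xs < g \<longrightarrow> \<not> cycle_list E xs) \<and>
    (\<forall>c :: 'v \<Rightarrow> nat. c ` S \<subseteq> {..<k} \<longrightarrow> (\<exists>u\<in>S. \<exists>v\<in>S. E u v \<and> c u = c v))"
proof -
  define n where "n = card V"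
  define m where "m = 4 * k * h"
  define I where "I = {..<m}"
  define \<Omega> where "\<Omega> = I \<rightarrow>\<^sub>E V"
  define C where "C l = {xs. length xs = l \<and> set xs \<subseteq> V \<and> cycle_list E xs}" for l
  have n: "n > 0" using V by (simp add: n_def card_gt_0_iff)
  have card\<Omega>: "card \<Omega> = n ^ m" by (simp add: \<Omega>_def I_def n_def card_PiE)
  have fin\<Omega>: "finite \<Omega>" using V by (auto simp: \<Omega>_def I_def intro!: finite_PiE)
  have split_card: "card (I - J \<rightarrow>\<^sub>E V) = n ^ (m - card J)" if "J \<subseteq> I" for J
    using that by (simp add: I_def n_def card_PiE card_Diff_subset finite_subset[OF that])
  define Bad1 where "Bad1 = {f \<in> \<Omega>. \<exists>J\<subseteq>I. card J = 2 * h \<and> independent_family E J f}"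
  \<comment> \<open>The exponent fits the union bound: \<open>(2 ^ (4 * k + 2)) ^ h\<close> equals
    \<open>2 ^ m * 4 ^ h\<close>, which bounds the number of index sets times the loss for each, and
    the remaining \<open>4 ^ h\<close> yields the quarter.\<close>
  have K4: "K = 4 * 2 ^ (4 * k + 2)" by (simp add: K_def power_add)
  have bad1: "4 * card Bad1 \<le> n ^ m"
  proof -
    have one: "card {f \<in> \<Omega>. independent_family E J f} * K ^ h \<le> n ^ m * 4 ^ h"
      if J: "J \<subseteq> I" "card J = 2 * h" for J
    proof -
      have finJ: "finite J" using J(1) by (auto simp: I_def intro: finite_subset)
      let ?F = "{f \<in> J \<rightarrow>\<^sub>E V. independent_family E J f}"
      let ?g = "\<lambda>f. (restrict f J, restrict f (I - J))"
      have "inj_on ?g \<Omega>"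
      proof (rule inj_onI)
        fix f f' assume ff: "f \<in> \<Omega>" "f' \<in> \<Omega>" "?g f = ?g f'"
        show "f = f'"
        proof (rule PiE_ext[of f I "\<lambda>_. V"])
          show "f i = f' i" if "i \<in> I" for i
            using ff(3) that by (auto simp: restrict_def fun_eq_iff split: if_splits)
        qed (use ff in \<open>auto simp: \<Omega>_def\<close>)
      qed
      then have "inj_on ?g {f \<in> \<Omega>. independent_family E J f}" by (rule inj_on_subset) auto
      moreover have "?g ` {f \<in> \<Omega>. independent_family E J f} \<subseteq> ?F \<times> (I - J \<rightarrow>\<^sub>E V)"
        using J(1) by (auto simp: \<Omega>_def independent_family_def PiE_iff subset_iff)
      moreover have "finite (?F \<times> (I - J \<rightarrow>\<^sub>E V))"
        using V finJ by (auto simp: I_def intro!: finite_cartesian_product finite_PiE)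
      ultimately have "card {f \<in> \<Omega>. independent_family E J f} \<le> card (?F \<times> (I - J \<rightarrow>\<^sub>E V))"
        using card_inj_on_le by blast
      also have "\<dots> = card ?F * n ^ (m - 2 * h)" using split_card J by (simp add: card_cartesian_product)
      finally have 1: "card {f \<in> \<Omega>. independent_family E J f} \<le> card ?F * n ^ (m - 2 * h)" .
      \<comment> \<open>With \<open>2 * h\<close> choices, the \<open>h\<close> factors
        \<open>K\<close> lost to high-degree choices are only half of those gained, so
        \<open>K ^ h\<close> remains.\<close>
      have "card ?F * K ^ (2 * h) \<le> (2 * n) ^ (2 * h) * K ^ h"
        using card_independent_families[OF V(1) b _ low finJ order_refl hb] J(2) by (simp add: n_def K_def)
      then have "card ?F * K ^ h * K ^ h \<le> (2 * n) ^ (2 * h) * K ^ h"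
        by (simp only: mult_2[of h] power_add mult.assoc)
      moreover have "K ^ h > 0" by (simp add: K_def)
      ultimately have 2: "card ?F * K ^ h \<le> (2 * n) ^ (2 * h)" by (meson mult_le_cancel2)
      have "card {f \<in> \<Omega>. independent_family E J f} * K ^ h \<le> card ?F * K ^ h * n ^ (m - 2 * h)"
        using mult_le_mono1[OF 1, of "K ^ h"] by (simp add: ac_simps)
      also have "\<dots> \<le> (2 * n) ^ (2 * h) * n ^ (m - 2 * h)" using 2 by (rule mult_le_mono1)
      also have "\<dots> = n ^ (2 * h + (m - 2 * h)) * 4 ^ h"
        by (simp add: power_mult_distrib power_add power_mult)
      also have "2 * h + (m - 2 * h) = m" using k by (simp add: m_def)
      finally show ?thesis .
    qed
    let ?\<J> = "{J. J \<subseteq> I \<and> card J = 2 * h}"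
    have fJ: "finite ?\<J>" by (simp add: I_def)
    have "card ?\<J> \<le> card (Pow I)" by (intro card_mono) (auto simp: I_def)
    then have cJ: "card ?\<J> \<le> 2 ^ m" by (simp add: I_def card_Pow)
    have "Bad1 \<subseteq> (\<Union>J\<in>?\<J>. {f \<in> \<Omega>. independent_family E J f})" by (auto simp: Bad1_def)
    then have "card Bad1 \<le> card (\<Union>J\<in>?\<J>. {f \<in> \<Omega>. independent_family E J f})"
      using fJ fin\<Omega> by (intro card_mono) auto
    also have "\<dots> \<le> (\<Sum>J\<in>?\<J>. card {f \<in> \<Omega>. independent_family E J f})" using fJ by (rule card_UN_le)
    finally have "card Bad1 * K ^ h \<le> (\<Sum>J\<in>?\<J>. card {f \<in> \<Omega>. independent_family E J f} * K ^ h)"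
      by (simp add: sum_distrib_right[symmetric])
    also have "\<dots> \<le> card ?\<J> * (n ^ m * 4 ^ h)"
      using sum_bounded_above[of ?\<J> "\<lambda>J. card {f \<in> \<Omega>. independent_family E J f} * K ^ h"] one by simp
    also have "\<dots> \<le> 2 ^ m * (n ^ m * 4 ^ h)" using cJ by (rule mult_le_mono1)
    also have "\<dots> = n ^ m * (2 ^ (4 * k + 2)) ^ h"
      by (simp add: m_def power_add power_mult power_mult_distrib)
    finally have "(card Bad1 * 4 ^ h) * (2 ^ (4 * k + 2)) ^ h \<le> n ^ m * (2 ^ (4 * k + 2)) ^ h"
      by (simp only: K4 power_mult_distrib mult.assoc)
    moreover have "((2::nat) ^ (4 * k + 2)) ^ h > 0" by simp
    ultimately have "card Bad1 * 4 ^ h \<le> n ^ m" by (meson mult_le_cancel2)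
    moreover have "(4::nat) \<le> 4 ^ h" using h by (cases h) auto
    ultimately show ?thesis by (metis le_trans mult.commute mult_le_mono1)
  qed
  \<comment> \<open>Collecting heads suffices: a short cycle among the surviving indices would have
    its own head deleted.\<close>
  define Del where "Del f = {i \<in> I. \<exists>js. set js \<subseteq> I \<and> 3 \<le> length js \<and> length js < g \<and>
     cycle_list E (map f js) \<and> i = hd js}" for f
  have finDel: "finite (Del f)" for f by (simp add: Del_def I_def)
  have del: "8 * (\<Sum>f\<in>\<Omega>. card (Del f)) \<le> m * n ^ m"
  proof -
    \<comment> \<open>At distinct indices the values of a random \<open>f\<close> are independent
      and uniform, so each tuple \<open>js\<close> becomes a cycle with probability at most
      \<open>card (C l) / n ^ l\<close>, where \<open>l = length js\<close>. A repeated index rules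
      out a cycle.\<close>
    have inner: "card {f \<in> \<Omega>. cycle_list E (map f js)} * n ^ length js \<le> card (C (length js)) * n ^ m"
      if js: "set js \<subseteq> I" for js
    proof (cases "distinct js")
      case True
      let ?l = "length js"
      have cd: "card (set js) = ?l" using True by (rule distinct_card)
      have lm: "?l \<le> m" using card_mono[OF _ js] cd by (simp add: I_def)
      let ?g = "\<lambda>f. (map f js, restrict f (I - set js))"
      have "inj_on ?g \<Omega>"
      proof (rule inj_onI)
        fix f f' assume ff: "f \<in> \<Omega>" "f' \<in> \<Omega>" "?g f = ?g f'"
        show "f = f'"
        proof (rule PiE_ext[of f I "\<lambda>_. V"])
          show "f i = f' i" if "i \<in> I" for i
            using ff(3) that by (cases "i \<in> set js") (auto simp: restrict_def fun_eq_iff split: if_splits)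
        qed (use ff in \<open>auto simp: \<Omega>_def\<close>)
      qed
      then have "inj_on ?g {f \<in> \<Omega>. cycle_list E (map f js)}" by (rule inj_on_subset) auto
      moreover have "?g ` {f \<in> \<Omega>. cycle_list E (map f js)} \<subseteq> C ?l \<times> (I - set js \<rightarrow>\<^sub>E V)"
        using js by (auto simp: \<Omega>_def C_def PiE_iff subset_iff)
      moreover have fC: "finite (C ?l)"
        using finite_lists_length_eq[OF V(1), of ?l] by (rule rev_finite_subset) (auto simp: C_def)
      then have "finite (C ?l \<times> (I - set js \<rightarrow>\<^sub>E V))"
        using V by (auto simp: I_def intro!: finite_cartesian_product finite_PiE)
      ultimately have "card {f \<in> \<Omega>. cycle_list E (map f js)} \<le> card (C ?l \<times> (I - set js \<rightarrow>\<^sub>E V))"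
        using card_inj_on_le by blast
      also have "\<dots> = card (C ?l) * n ^ (m - ?l)" using split_card[OF js] cd by (simp add: card_cartesian_product)
      finally have "card {f \<in> \<Omega>. cycle_list E (map f js)} * n ^ ?l \<le> card (C ?l) * n ^ (m - ?l) * n ^ ?l"
        by (rule mult_le_mono1)
      also have "\<dots> = card (C ?l) * n ^ m" using lm by (simp add: mult.assoc power_add[symmetric])
      finally show ?thesis .
    next
      case False
      then have *: "{f \<in> \<Omega>. cycle_list E (map f js)} = {}" by (auto simp: cycle_list_def distinct_map)
      show ?thesis unfolding * by simp
    qed
    define X where "X l = {(js, f). length js = l \<and> set js \<subseteq> I \<and> f \<in> \<Omega> \<and> cycle_list E (map f js)}" for l
    define L where "L l = {js. set js \<subseteq> I \<and> length js = l}" for l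
    have finL: "finite (L l)" for l unfolding L_def by (rule finite_lists_length_eq) (simp add: I_def)
    have XL: "X l = Sigma (L l) (\<lambda>js. {f \<in> \<Omega>. cycle_list E (map f js)})" for l
      by (auto simp: X_def L_def)
    have finX: "finite (X l)" for l unfolding XL using finL fin\<Omega> by auto
    have cardX: "8 * g * card (X l) \<le> m * n ^ m" if l: "3 \<le> l" "l < g" for l
    proof -
      have "card (X l) = (\<Sum>js\<in>L l. card {f \<in> \<Omega>. cycle_list E (map f js)})"
        unfolding XL using finL fin\<Omega> by (subst card_SigmaI) auto
      then have "card (X l) * n ^ l = (\<Sum>js\<in>L l. card {f \<in> \<Omega>. cycle_list E (map f js)} * n ^ l)"
        by (simp add: sum_distrib_right)
      also have "\<dots> \<le> card (L l) * (card (C l) * n ^ m)"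
        by (rule order_trans[OF sum_bounded_above[of _ _ "card (C l) * n ^ m"]]) (auto simp: L_def dest: inner)
      also have "card (L l) = m ^ l"
        unfolding L_def by (subst card_lists_length_eq) (auto simp: I_def)
      finally have "8 * g * (card (X l) * n ^ l) \<le> 8 * g * (m ^ l * (card (C l) * n ^ m))"
        by (rule mult_le_mono2)
      also have "\<dots> = (8 * g * m ^ l * card (C l)) * n ^ m" by (simp only: ac_simps)
      also have "\<dots> \<le> (m * n ^ l) * n ^ m"
        using cyc[OF l] unfolding m_def n_def C_def by (rule mult_le_mono1)
      finally have "(8 * g * card (X l)) * n ^ l \<le> (m * n ^ m) * n ^ l" by (simp only: ac_simps)
      then show ?thesis using n by simp
    qed
    have "Sigma \<Omega> Del \<subseteq> (\<lambda>(js, f). (f, hd js)) ` (\<Union>l\<in>{3..<g}. X l)"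
      by (force simp: Del_def X_def)
    then have "card (Sigma \<Omega> Del) \<le> card (\<Union>l\<in>{3..<g}. X l)"
      using finX by (intro surj_card_le) auto
    also have "\<dots> \<le> (\<Sum>l\<in>{3..<g}. card (X l))" by (rule card_UN_le) simp
    finally have "(\<Sum>f\<in>\<Omega>. card (Del f)) \<le> (\<Sum>l\<in>{3..<g}. card (X l))"
      using fin\<Omega> finDel by (subst (asm) card_SigmaI) auto
    then have "8 * g * (\<Sum>f\<in>\<Omega>. card (Del f)) \<le> 8 * g * (\<Sum>l\<in>{3..<g}. card (X l))" by (rule mult_le_mono2)
    also have "\<dots> = (\<Sum>l\<in>{3..<g}. 8 * g * card (X l))" by (rule sum_distrib_left)
    also have "\<dots> \<le> card {3..<g} * (m * n ^ m)"
      using sum_bounded_above[of "{3..<g}" "\<lambda>l. 8 * g * card (X l)" "m * n ^ m"] cardX by simp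
    also have "\<dots> \<le> g * (m * n ^ m)" by (intro mult_le_mono1) simp
    finally have "g * (8 * (\<Sum>f\<in>\<Omega>. card (Del f))) \<le> g * (m * n ^ m)" by (simp only: ac_simps)
    then show ?thesis using g by simp
  qed
  define Bad2 where "Bad2 = {f \<in> \<Omega>. 2 * k * h < card (Del f)}"
  have bad2: "4 * card Bad2 \<le> n ^ m"
  proof -
    have "card Bad2 * (2 * k * h) \<le> (\<Sum>f\<in>Bad2. card (Del f))"
      using sum_bounded_below[of Bad2 "2 * k * h" "\<lambda>f. card (Del f)"] by (simp add: Bad2_def)
    also have "\<dots> \<le> (\<Sum>f\<in>\<Omega>. card (Del f))" using fin\<Omega> by (intro sum_mono2) (auto simp: Bad2_def)
    finally have "8 * (card Bad2 * (2 * k * h)) \<le> m * n ^ m" using del by linarith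
    then have "(4 * k * h) * (4 * card Bad2) \<le> (4 * k * h) * n ^ m" by (simp add: m_def ac_simps)
    then show ?thesis using k h by simp
  qed
  have "\<exists>f\<in>\<Omega>. f \<notin> Bad1 \<union> Bad2"
  proof (rule ccontr)
    assume "\<not> ?thesis"
    then have "\<Omega> \<subseteq> Bad1 \<union> Bad2" by auto
    moreover have "finite Bad1" "finite Bad2" using fin\<Omega> by (auto simp: Bad1_def Bad2_def)
    ultimately have "n ^ m \<le> card Bad1 + card Bad2"
      using card\<Omega> card_mono[of "Bad1 \<union> Bad2" \<Omega>] card_Un_le[of Bad1 Bad2] by simp
    moreover have "n ^ m > 0" using n by simp
    ultimately show False using bad1 bad2 by linarith
  qed
  then obtain f where f: "f \<in> \<Omega>" "f \<notin> Bad1" "f \<notin> Bad2" by auto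
  define J where "J = I - Del f"
  have J: "finite J" "J \<subseteq> I" by (auto simp: J_def I_def)
  have cJ: "2 * k * h \<le> card J"
  proof -
    have "Del f \<subseteq> I" by (auto simp: Del_def)
    then have "card J = m - card (Del f)" using finDel by (simp add: J_def card_Diff_subset I_def)
    then show ?thesis using f by (simp add: Bad2_def m_def)
  qed
  show ?thesis
  proof (intro exI[of _ "f ` J"] conjI allI impI)
    show "f ` J \<subseteq> V" using f(1) J by (auto simp: \<Omega>_def)
  next
    fix xs assume xs: "set xs \<subseteq> f ` J" "3 \<le> length xs" "length xs < g"
    show "\<not> cycle_list E xs"
    proof
      assume c: "cycle_list E xs"
      have "xs \<in> map f ` lists J" using xs(1) by (auto simp: lists_image[symmetric])
      then obtain js where js: "xs = map f js" "set js \<subseteq> J" by auto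
      have hdJ: "hd js \<in> J" using js xs(2) by (cases js) auto
      then have "hd js \<in> Del f"
        using js c xs J unfolding Del_def by (intro CollectI conjI exI[of _ js]) auto
      then show False using hdJ by (simp add: J_def)
    qed
  next
    fix c :: "'v \<Rightarrow> nat" assume c: "c ` f ` J \<subseteq> {..<k}"
    show "\<exists>u\<in>f ` J. \<exists>v\<in>f ` J. E u v \<and> c u = c v"
    proof (rule ccontr)
      assume no: "\<not> ?thesis"
      have small: "card {i \<in> J. c (f i) = t} < 2 * h" for t
      proof (rule ccontr)
        assume "\<not> ?thesis"
        then have "2 * h \<le> card {i \<in> J. c (f i) = t}" by simp
        then obtain J' where J': "J' \<subseteq> {i \<in> J. c (f i) = t}" "card J' = 2 * h"
          by (rule obtain_subset_with_card_n)
        have "independent_family E J' f"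
          unfolding independent_family_def
        proof (intro ballI notI)
          fix i j assume "i \<in> J'" "j \<in> J'" "E (f i) (f j)"
          then show False using no J'(1) by (metis (mono_tags, lifting) imageI mem_Collect_eq subsetD)
        qed
        moreover have "J' \<subseteq> I" using J J' by auto
        ultimately show False using f J' by (auto simp: Bad1_def)
      qed
      have "J = (\<Union>t<k. {i \<in> J. c (f i) = t})" using c by auto
      then have "card J \<le> (\<Sum>t<k. card {i \<in> J. c (f i) = t})"
        using card_UN_le[of "{..<k}" "\<lambda>t. {i \<in> J. c (f i) = t}"] by simp
      also have "\<dots> < (\<Sum>t<k. 2 * h)" using small k by (intro sum_strict_mono) auto
      finally show False using cJ by (simp add: ac_simps)
    qed
  qed
qed

subsection \<open>Axis-parallel lines of a grid\<close>

text \<open>The pair \<open>(i, x)\<close> encodes the line of the grid \<open>{..<R}\<^sup>R\<close> that is parallel to the \<open>i\<close>-th axis and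
  whose other coordinates are given by \<open>x\<close>.\<close>

definition grid_lines :: "nat \<Rightarrow> (nat \<times> (nat \<Rightarrow> nat)) set" where
  "grid_lines R = (SIGMA i:{..<R}. {..<R} - {i} \<rightarrow>\<^sub>E {..<R})"

text \<open>A common point takes its coordinate \<open>fst u\<close> from \<open>v\<close> and its
  coordinate \<open>fst v\<close> from \<open>u\<close>, so only the other coordinates have to
  agree.\<close>

definition crossing :: "nat \<Rightarrow> nat \<times> (nat \<Rightarrow> nat) \<Rightarrow> nat \<times> (nat \<Rightarrow> nat) \<Rightarrow> bool" where
  "crossing R u v \<longleftrightarrow> fst u \<noteq> fst v \<and> (\<forall>t\<in>{..<R} - {fst u, fst v}. snd u t = snd v t)"

lemma finite_grid_lines: "finite (grid_lines R)"
  by (auto simp: grid_lines_def intro!: finite_PiE)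

lemma card_grid_lines: "R > 0 \<Longrightarrow> card (grid_lines R) = R ^ R"
  by (cases R) (auto simp: grid_lines_def card_SigmaI card_PiE finite_PiE)

lemma grid_lines_eqI:
  assumes "u \<in> grid_lines R" "v \<in> grid_lines R" "fst u = fst v"
    and "\<And>t. t < R \<Longrightarrow> t \<noteq> fst u \<Longrightarrow> snd u t = snd v t"
  shows "u = v"
proof (rule prod_eqI)
  show "snd u = snd v"
    by (rule PiE_ext[of _ "{..<R} - {fst u}" "\<lambda>_. {..<R}"]) (use assms in \<open>auto simp: grid_lines_def\<close>)
qed (fact assms(3))

text \<open>Once its direction is given, a line crossing \<open>u\<close> is determined by its
  coordinate \<open>fst u\<close>, that is, by the point where it meets \<open>u\<close>.\<close>

lemma card_crossing_direction:
  assumes "u \<in> grid_lines R"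
  shows "card {v \<in> grid_lines R. crossing R u v \<and> fst v = i} \<le> R"
proof -
  have "inj_on (\<lambda>v. snd v (fst u)) {v \<in> grid_lines R. crossing R u v \<and> fst v = i}"
  proof (rule inj_onI)
    fix v w
    assume v: "v \<in> {v \<in> grid_lines R. crossing R u v \<and> fst v = i}"
      and w: "w \<in> {v \<in> grid_lines R. crossing R u v \<and> fst v = i}"
      and eq: "snd v (fst u) = snd w (fst u)"
    show "v = w"
    proof (rule grid_lines_eqI)
      fix t assume "t < R" "t \<noteq> fst v"
      then show "snd v t = snd w t" using v w eq by (cases "t = fst u") (auto simp: crossing_def)
    qed (use v w in auto)
  qed
  moreover have "(\<lambda>v. snd v (fst u)) ` {v \<in> grid_lines R. crossing R u v \<and> fst v = i} \<subseteq> {..<R}"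
    using assms by (auto simp: grid_lines_def crossing_def PiE_iff)
  ultimately have "card {v \<in> grid_lines R. crossing R u v \<and> fst v = i} \<le> card {..<R}"
    by (rule card_inj_on_le) simp
  then show ?thesis by simp
qed

lemma card_crossing:
  assumes "u \<in> grid_lines R"
  shows "card {v \<in> grid_lines R. crossing R u v} \<le> R * R"
proof -
  have "{v \<in> grid_lines R. crossing R u v} = (\<Union>i<R. {v \<in> grid_lines R. crossing R u v \<and> fst v = i})"
    by (auto simp: grid_lines_def)
  then have "card {v \<in> grid_lines R. crossing R u v}
      = card (\<Union>i<R. {v \<in> grid_lines R. crossing R u v \<and> fst v = i})"
    by (rule arg_cong)
  also have "\<dots> \<le> (\<Sum>i<R. card {v \<in> grid_lines R. crossing R u v \<and> fst v = i})"
    by (rule card_UN_le) simp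
  also have "\<dots> \<le> R * R"
    using sum_bounded_above[of "{..<R}" "\<lambda>i. card {v \<in> grid_lines R. crossing R u v \<and> fst v = i}" R]
      card_crossing_direction[OF assms] by simp
  finally show ?thesis .
qed

section \<open>Counting walks and cycles\<close>

lemma card_snoc_le:
  assumes "finite A" "\<And>ys. ys \<in> A \<Longrightarrow> finite (f ys)" "\<And>ys. ys \<in> A \<Longrightarrow> card (f ys) \<le> B"
    and "\<And>xs. xs \<in> X \<Longrightarrow> \<exists>ys\<in>A. \<exists>v\<in>f ys. xs = ys @ [v]"
  shows "card X \<le> card A * B"
proof -
  have "X \<subseteq> (\<lambda>(ys, v). ys @ [v]) ` Sigma A f" using assms(4) by force
  then have "card X \<le> card (Sigma A f)" using assms by (intro surj_card_le) auto
  also have "\<dots> = (\<Sum>ys\<in>A. card (f ys))" using assms by (simp add: card_SigmaI)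
  also have "\<dots> \<le> card A * B" using sum_bounded_above[of A "\<lambda>ys. card (f ys)" B] assms by simp
  finally show ?thesis .
qed

lemma card_walks_le:
  assumes V: "finite V" and D: "\<And>u. u \<in> V \<Longrightarrow> card {v \<in> V. E u v} \<le> D"
  shows "card {xs. length xs = Suc l \<and> set xs \<subseteq> V \<and> successively E xs} \<le> card V * D ^ l"
proof (induction l)
  case 0
  have "{xs. length xs = Suc 0 \<and> set xs \<subseteq> V \<and> successively E xs} \<subseteq> (\<lambda>v. [v]) ` V"
    by (auto simp: length_Suc_conv)
  then show ?case using V by (simp add: surj_card_le)
next
  case (Suc l)
  let ?W = "\<lambda>l. {xs. length xs = Suc l \<and> set xs \<subseteq> V \<and> successively E xs}"
  have fin: "finite (?W l)"
    using finite_lists_length_eq[OF V, of "Suc l"] by (rule rev_finite_subset) auto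
  have "card (?W (Suc l)) \<le> card (?W l) * D"
  proof (rule card_snoc_le[OF fin, of "\<lambda>ys. {v \<in> V. E (last ys) v}"])
    fix ys assume "ys \<in> ?W l"
    then have "last ys \<in> V" using last_in_set[of ys] by (cases ys) auto
    then show "card {v \<in> V. E (last ys) v} \<le> D" by (rule D)
  next
    fix xs assume xs: "xs \<in> ?W (Suc l)"
    then obtain ys v where "xs = ys @ [v]" by (cases xs rule: rev_cases) auto
    then show "\<exists>ys\<in>?W l. \<exists>v\<in>{v \<in> V. E (last ys) v}. xs = ys @ [v]"
      using xs by (auto simp: successively_append_iff)
  qed (use V in auto)
  also have "\<dots> \<le> card V * D ^ l * D" using Suc.IH by (rule mult_le_mono1)
  finally show ?case by (simp add: ac_simps)
qed

text \<open>Consecutive lines agree in every coordinate that is not one of their two directions, and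
  \<open>i\<close> is never a direction.\<close>

lemma crossing_walk_constant:
  assumes "successively (crossing R) xs" "i < R" "i \<notin> fst ` set xs" "u \<in> set xs"
  shows "snd u i = snd (hd xs) i"
  using assms
proof (induction xs arbitrary: u rule: induct_list012)
  case (3 x y zs)
  have "snd x i = snd y i" using 3(3-5) by (auto simp: crossing_def)
  moreover have "snd u i = snd y i" if "u \<in> set (y # zs)"
    using "3.IH"(2)[OF _ _ _ that] "3.prems" by simp
  ultimately show ?case using "3.prems"(4) by (cases "u = x") simp_all
qed auto

text \<open>If the closing line \<open>v\<close> of a cycle is the only one in its direction, then moving along the
  other lines does not change the coordinate \<open>fst v\<close>, so the two neighbours of \<open>v\<close> meet \<open>v\<close> in the
  same point, and this point determines \<open>v\<close> up to its direction.\<close>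

lemma card_closing_lines:
  assumes ys: "set ys \<subseteq> grid_lines R" "2 \<le> length ys"
  shows "card {v \<in> grid_lines R. cycle_list (crossing R) (ys @ [v])} \<le> Suc (length ys) * R"
proof -
  define G where "G = grid_lines R"
  \<comment> \<open>Closing lines parallel to some line of \<open>ys\<close>: at most
    \<open>R\<close> for each such direction. The others, \<open>New\<close>, number at most one per
    direction.\<close>
  define Rep where "Rep = (\<Union>u\<in>set ys. {v \<in> G. crossing R (last ys) v \<and> fst v = fst u})"
  define New where "New = {v \<in> G. cycle_list (crossing R) (ys @ [v]) \<and> fst v \<notin> fst ` set ys}"
  have fin: "finite G" by (simp add: G_def finite_grid_lines)
  have ne: "ys \<noteq> []" using ys by auto
  then have lastG: "last ys \<in> G" and hdG: "hd ys \<in> G" using ys by (auto simp: G_def)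
  have "{v \<in> G. cycle_list (crossing R) (ys @ [v])} \<subseteq> Rep \<union> New"
    using ne by (auto simp: Rep_def New_def cycle_list_def successively_append_iff image_iff)
  then have "card {v \<in> G. cycle_list (crossing R) (ys @ [v])} \<le> card (Rep \<union> New)"
    using fin by (intro card_mono) (auto simp: Rep_def New_def)
  also have "\<dots> \<le> card Rep + card New" by (rule card_Un_le)
  also have "card Rep \<le> length ys * R"
  proof -
    have "card Rep \<le> (\<Sum>u\<in>set ys. card {v \<in> G. crossing R (last ys) v \<and> fst v = fst u})"
      unfolding Rep_def by (rule card_UN_le) simp
    also have "\<dots> \<le> card (set ys) * R"
      using sum_bounded_above[of "set ys" "\<lambda>u. card {v \<in> G. crossing R (last ys) v \<and> fst v = fst u}" R]
        card_crossing_direction[of "last ys" R] lastG by (simp add: G_def)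
    also have "\<dots> \<le> length ys * R" by (intro mult_le_mono1 card_length)
    finally show ?thesis .
  qed
  also have "card New \<le> R"
  proof -
    have "inj_on fst New"
    proof (rule inj_onI)
      fix v w assume vw: "v \<in> New" "w \<in> New" "fst v = fst w"
      define i where "i = fst v"
      have i: "i < R" "i \<notin> fst ` set ys" using vw(1) by (auto simp: New_def G_def grid_lines_def i_def)
      have v: "crossing R (last ys) v" "crossing R v (hd ys)" and w: "crossing R (last ys) w" "crossing R w (hd ys)"
        and walk: "distinct ys" "successively (crossing R) ys"
        using vw ne by (auto simp: New_def cycle_list_def successively_append_iff)
      \<comment> \<open>Parallel end lines would agree in coordinate \<open>i\<close> because the
        walk keeps it constant, and in the others through \<open>v\<close>; they would coincide,
        against distinctness.\<close>
      have neq: "fst (hd ys) \<noteq> fst (last ys)"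
      proof
        assume eq: "fst (hd ys) = fst (last ys)"
        have "hd ys = last ys"
        proof (rule grid_lines_eqI)
          fix t assume t: "t < R" "t \<noteq> fst (hd ys)"
          show "snd (hd ys) t = snd (last ys) t"
          proof (cases "t = i")
            case True
            then show ?thesis using crossing_walk_constant[OF walk(2) i, of "last ys"] ne by simp
          next
            case False
            then show ?thesis using t v eq by (auto simp: crossing_def i_def)
          qed
        qed (use hdG lastG eq in \<open>auto simp: G_def\<close>)
        then show False using walk(1) ys(2) by (cases ys) (auto split: if_splits)
      qed
      show "v = w"
      proof (rule grid_lines_eqI)
        fix t assume t: "t < R" "t \<noteq> fst v"
        show "snd v t = snd w t"
        \<comment> \<open>The coordinates of \<open>v\<close> are read off from
          \<open>last ys\<close>, except the one in the direction of \<open>last ys\<close>, which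
          is read off from \<open>hd ys\<close>.\<close>
        proof (cases "t = fst (last ys)")
          case True
          then show ?thesis using t v(2) w(2) vw(3) neq by (auto simp: crossing_def)
        next
          case False
          then show ?thesis using t v(1) w(1) vw(3) by (auto simp: crossing_def)
        qed
      qed (use vw in \<open>auto simp: New_def G_def\<close>)
    qed
    moreover have "fst ` New \<subseteq> {..<R}" by (auto simp: New_def G_def grid_lines_def)
    ultimately show ?thesis using card_inj_on_le[of fst New "{..<R}"] by simp
  qed
  finally show ?thesis by (simp add: G_def)
qed

text \<open>A walk has at most \<open>R * R\<close> choices at each step, but the closing line has
  only \<open>(l + 3) * R\<close>. The factor of order \<open>R\<close> saved here makes short
  cycles rare.\<close>

lemma card_grid_cycles:
  assumes "R > 0"
  shows "card {xs. length xs = l + 3 \<and> set xs \<subseteq> grid_lines R \<and> cycle_list (crossing R) xs}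
    \<le> R ^ R * (R * R) ^ (l + 1) * ((l + 3) * R)"
proof -
  let ?W = "{xs. length xs = Suc (l + 1) \<and> set xs \<subseteq> grid_lines R \<and> successively (crossing R) xs}"
  have fin: "finite ?W"
    using finite_lists_length_eq[OF finite_grid_lines[of R], of "Suc (l + 1)"] by (rule rev_finite_subset) auto
  have "card {xs. length xs = l + 3 \<and> set xs \<subseteq> grid_lines R \<and> cycle_list (crossing R) xs}
      \<le> card ?W * ((l + 3) * R)"
  proof (rule card_snoc_le[OF fin, of "\<lambda>ys. {v \<in> grid_lines R. cycle_list (crossing R) (ys @ [v])}"])
    fix ys assume "ys \<in> ?W"
    then show "card {v \<in> grid_lines R. cycle_list (crossing R) (ys @ [v])} \<le> (l + 3) * R"
      using card_closing_lines[of ys R] by (simp add: eval_nat_numeral)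
  next
    fix xs assume xs: "xs \<in> {xs. length xs = l + 3 \<and> set xs \<subseteq> grid_lines R \<and> cycle_list (crossing R) xs}"
    then obtain ys v where "xs = ys @ [v]" by (cases xs rule: rev_cases) auto
    then show "\<exists>ys\<in>?W. \<exists>v\<in>{v \<in> grid_lines R. cycle_list (crossing R) (ys @ [v])}. xs = ys @ [v]"
      using xs by (auto simp: successively_append_iff cycle_list_def)
  qed (auto simp: finite_grid_lines)
  also have "\<dots> \<le> R ^ R * (R * R) ^ (l + 1) * ((l + 3) * R)"
    using card_walks_le[OF finite_grid_lines[of R] card_crossing, where l = "l + 1"] assms
    by (intro mult_le_mono1) (simp add: card_grid_lines)
  finally show ?thesis .
qed

section \<open>Incidences between grid points and lines\<close>

definition on_line :: "nat \<Rightarrow> (nat \<Rightarrow> nat) \<Rightarrow> nat \<times> (nat \<Rightarrow> nat) \<Rightarrow> bool" where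
  "on_line R p v \<longleftrightarrow> restrict p ({..<R} - {fst v}) = snd v"

lemma on_lineD: "on_line R p v \<Longrightarrow> t < R \<Longrightarrow> t \<noteq> fst v \<Longrightarrow> p t = snd v t"
  unfolding on_line_def by (drule fun_cong[of _ _ t]) simp

lemma card_points_on_line:
  assumes "v \<in> grid_lines R"
  shows "card {p \<in> {..<R} \<rightarrow>\<^sub>E {..<R}. on_line R p v} = R"
proof -
  have v: "fst v < R" "snd v \<in> {..<R} - {fst v} \<rightarrow>\<^sub>E {..<R}"
    using assms by (cases v, simp only: grid_lines_def mem_Sigma_iff fst_conv snd_conv lessThan_iff)+
  have "bij_betw (\<lambda>p. p (fst v)) {p \<in> {..<R} \<rightarrow>\<^sub>E {..<R}. on_line R p v} {..<R}"
  proof (rule bij_betwI[where g = "\<lambda>s. (snd v)(fst v := s)"])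
    show "(\<lambda>s. (snd v)(fst v := s)) \<in> {..<R} \<rightarrow> {p \<in> {..<R} \<rightarrow>\<^sub>E {..<R}. on_line R p v}"
    proof
      fix s assume "s \<in> {..<R}"
      then have "(snd v)(fst v := s) \<in> {..<R} \<rightarrow>\<^sub>E {..<R}"
        using v by (auto simp: PiE_iff extensional_def)
      moreover have "restrict ((snd v)(fst v := s)) ({..<R} - {fst v}) t = snd v t" for t
        using PiE_arb[OF v(2), of t] by (cases "t \<in> {..<R} - {fst v}") auto
      ultimately show "(snd v)(fst v := s) \<in> {p \<in> {..<R} \<rightarrow>\<^sub>E {..<R}. on_line R p v}"
        by (auto simp: on_line_def)
    qed
    fix p assume p: "p \<in> {p \<in> {..<R} \<rightarrow>\<^sub>E {..<R}. on_line R p v}"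
    show "(snd v)(fst v := p (fst v)) = p"
    proof (rule PiE_ext[of _ "{..<R}" "\<lambda>_. {..<R}"])
      show "(snd v)(fst v := p (fst v)) \<in> {..<R} \<rightarrow>\<^sub>E {..<R}"
        using v p by (auto simp: PiE_iff extensional_def)
    qed (use p in \<open>auto dest: on_lineD\<close>)
  qed (use v in auto)
  from bij_betw_same_card[OF this] show ?thesis by simp
qed

text \<open>Distinct lines with a common point have different directions, so each coordinate of the
  point is fixed by one of them. With two summands, the sum over all pairs splits into a diagonal
  part and the number of crossing pairs.\<close>

lemma card_common_points:
  assumes "v \<in> grid_lines R" "w \<in> grid_lines R"
  shows "card {p \<in> {..<R} \<rightarrow>\<^sub>E {..<R}. on_line R p v \<and> on_line R p w}
    \<le> (if v = w then R else 0) + (if crossing R v w then 1 else 0)"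
proof -
  let ?S = "{p \<in> {..<R} \<rightarrow>\<^sub>E {..<R}. on_line R p v \<and> on_line R p w}"
  consider "v = w" | "v \<noteq> w" "?S = {}" | p where "v \<noteq> w" "p \<in> ?S" by blast
  then show ?thesis
  proof cases
    case 1
    then show ?thesis using card_points_on_line[OF assms(1)] by simp
  next
    case 2
    show ?thesis unfolding 2(2) by simp
  next
    case 3
    then have p: "p \<in> {..<R} \<rightarrow>\<^sub>E {..<R}" "on_line R p v" "on_line R p w" by simp_all
    have neq: "fst v \<noteq> fst w"
      using p(2,3) \<open>v \<noteq> w\<close> unfolding on_line_def by (metis prod_eqI)
    have "crossing R v w"
      unfolding crossing_def
    proof (intro conjI ballI)
      fix t assume t: "t \<in> {..<R} - {fst v, fst w}"
      then have "p t = snd v t" "p t = snd w t" by (auto intro: on_lineD[OF p(2)] on_lineD[OF p(3)])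
      then show "snd v t = snd w t" by simp
    qed (fact neq)
    moreover have "q = p" if q: "q \<in> ?S" for q
    proof (rule PiE_ext[of _ "{..<R}" "\<lambda>_. {..<R}"])
      have qv: "on_line R q v" and qw: "on_line R q w" using q by simp_all
      fix t assume "t \<in> {..<R}"
      then have t: "t < R" by simp
      show "q t = p t"
      proof (cases "t = fst v")
        case True
        then have "t \<noteq> fst w" using neq by simp
        then show ?thesis using on_lineD[OF qw t] on_lineD[OF p(3) t] by simp
      next
        case False
        then show ?thesis using on_lineD[OF qv t] on_lineD[OF p(2) t] by simp
      qed
    qed (use q p in simp_all)
    then have "card ?S \<le> card {p}" by (intro card_mono) auto
    ultimately show ?thesis using \<open>v \<noteq> w\<close> by simp
  qed
qed

text \<open>By Cauchy--Schwarz over the grid points, a set of more than \<open>R ^ R / K\<close> lines contains a line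
  that crosses at least \<open>R * r\<close> of them; this is applied to the set of lines of low degree itself.\<close>

lemma card_low_crossing:
  assumes "A \<subseteq> grid_lines R" "R = 2 * K * r" "K > 0" "r > 0"
  shows "card {v \<in> A. card {w \<in> A. crossing R v w} < R * r} * K \<le> card (grid_lines R)"
proof (rule ccontr)
  have R: "R > 0" using assms by simp
  define L where "L = {v \<in> A. card {w \<in> A. crossing R v w} < R * r}"
  define P where "P = ({..<R} \<rightarrow>\<^sub>E {..<R})"
  assume "\<not> ?thesis"
  then have big: "R ^ R < card L * K" using R by (simp add: L_def card_grid_lines)
  have finA: "finite A" using assms(1) finite_grid_lines finite_subset by blast
  then have finL: "finite L" by (simp add: L_def)
  have LG: "v \<in> grid_lines R" if "v \<in> L" for v using that assms(1) by (auto simp: L_def)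
  have finP: "finite P" by (auto simp: P_def intro!: finite_PiE)
  define c where "c p = card {v \<in> L. on_line R p v}" for p
  \<comment> \<open>The first moment of the number \<open>c p\<close> of lines of \<open>L\<close>
    through \<open>p\<close>; the second moment below counts pairs of lines with a common
    point.\<close>
  have c1: "(\<Sum>p\<in>P. c p) = R * card L"
    unfolding c_def
    by (rule sum_multicount[OF finP finL]) (auto simp: P_def LG card_points_on_line)
  have "(\<Sum>p\<in>P. (c p)\<^sup>2) = (\<Sum>p\<in>P. card {q \<in> L \<times> L. on_line R p (fst q) \<and> on_line R p (snd q)})"
  proof (rule sum.cong[OF refl])
    fix p
    have "{q \<in> L \<times> L. on_line R p (fst q) \<and> on_line R p (snd q)} = {v \<in> L. on_line R p v} \<times> {v \<in> L. on_line R p v}"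
      by auto
    then show "(c p)\<^sup>2 = card {q \<in> L \<times> L. on_line R p (fst q) \<and> on_line R p (snd q)}"
      by (simp add: c_def card_cartesian_product power2_eq_square)
  qed
  also have "\<dots> = (\<Sum>q\<in>L \<times> L. card {p \<in> P. on_line R p (fst q) \<and> on_line R p (snd q)})"
    by (rule sum_multicount_gen) (use finP finL in auto)
  also have "\<dots> \<le> (\<Sum>q\<in>L \<times> L. (if fst q = snd q then R else 0) + (if crossing R (fst q) (snd q) then 1 else 0))"
    unfolding P_def by (intro sum_mono card_common_points) (auto simp: LG)
  also have "\<dots> = (\<Sum>v\<in>L. \<Sum>w\<in>L. (if v = w then R else 0) + (if crossing R v w then 1 else 0))"
    by (simp add: sum.cartesian_product case_prod_unfold)
  also have "\<dots> = (\<Sum>v\<in>L. R + card {w \<in> L. crossing R v w})"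
    using finL by (simp add: sum.distrib sum.inter_filter[symmetric])
  also have "\<dots> \<le> (\<Sum>v\<in>L. R + R * r)"
  proof (intro sum_mono add_left_mono)
    fix v assume "v \<in> L"
    moreover have "card {w \<in> L. crossing R v w} \<le> card {w \<in> A. crossing R v w}"
      using finA by (intro card_mono) (auto simp: L_def)
    ultimately show "card {w \<in> L. crossing R v w} \<le> R * r" by (simp add: L_def)
  qed
  finally have c2: "(\<Sum>p\<in>P. (c p)\<^sup>2) \<le> card L * (R + R * r)" by simp
  have "(\<Sum>p\<in>P. real (c p))\<^sup>2 \<le> (\<Sum>p\<in>P. (real (c p))\<^sup>2) * card P"
    by (rule sum_squared_le_sum_of_squares)
  then have "real ((\<Sum>p\<in>P. c p)\<^sup>2) \<le> real ((\<Sum>p\<in>P. (c p)\<^sup>2) * card P)" by simp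
  then have "(\<Sum>p\<in>P. c p)\<^sup>2 \<le> (\<Sum>p\<in>P. (c p)\<^sup>2) * card P" by (simp only: of_nat_le_iff)
  also have "card P = R ^ R" by (simp add: P_def card_PiE)
  finally have "(R * card L)\<^sup>2 \<le> card L * (R + R * r) * R ^ R"
    using mult_le_mono1[OF c2, of "R ^ R"] unfolding c1 by linarith
  then have "card L * R * (R * card L) \<le> card L * R * ((1 + r) * R ^ R)"
    by (simp add: power2_eq_square algebra_simps)
  moreover have "card L * R > 0" using big R by (cases "card L") auto
  ultimately have "R * card L \<le> (1 + r) * R ^ R" by (meson mult_le_cancel1)
  then have "R * card L * K \<le> (1 + r) * R ^ R * K" by (rule mult_le_mono1)
  moreover have "R * R ^ R < R * card L * K" using big R by (simp add: mult.assoc)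
  ultimately have "R * R ^ R < (1 + r) * R ^ R * K" by linarith
  then have "R * R ^ R < ((1 + r) * K) * R ^ R" by (simp only: mult.assoc mult.commute[of K])
  then have "R < (1 + r) * K" by (simp only: mult_less_cancel2)
  also have "\<dots> \<le> (2 * r) * K" using assms by (intro mult_le_mono1) simp
  finally show False using assms(2) by (simp add: ac_simps)
qed

subsection \<open>Generic projection to three-space\<close>

text \<open>If \<open>b\<close> is the larger exponent, the sum exceeds \<open>3 ^ b\<close> and is
  at most \<open>2 * 3 ^ b\<close>, which leaves only \<open>b = c\<close>.\<close>

lemma power3_add_power3_eq:
  fixes a b c :: nat
  assumes "(3::nat) ^ a + 3 ^ b = 2 * 3 ^ c"
  shows "a = c \<and> b = c"
proof -
  have *: "a = c \<and> b = c" if eq: "(3::nat) ^ a + 3 ^ b = 2 * 3 ^ c" and "a \<le> b" for a b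
  proof -
    have "c < Suc b"
    proof (rule power_less_imp_less_exp[of "3::nat"])
      have "(3::nat) ^ a \<le> 3 ^ b" using \<open>a \<le> b\<close> by simp
      moreover have "(3::nat) ^ b > 0" by simp
      ultimately show "(3::nat) ^ c < 3 ^ Suc b" using eq unfolding power_Suc by linarith
    qed simp
    moreover have "\<not> c < b"
    proof
      assume "c < b"
      then have "(3::nat) ^ Suc c \<le> 3 ^ b" by (intro power_increasing) auto
      moreover have "(3::nat) ^ c > 0" "(3::nat) ^ a > 0" by simp_all
      ultimately show False using eq unfolding power_Suc by linarith
    qed
    ultimately have "b = c" by simp
    then have "(3::nat) ^ a = 3 ^ c" using eq by simp
    then show ?thesis using \<open>b = c\<close> by simp
  qed
  show ?thesis
  proof (cases "a \<le> b")
    case False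
    then show ?thesis using *[of b a] assms by (simp add: add.commute)
  qed (use * assms in simp)
qed

text \<open>As polynomials in \<open>X\<close> the sums below are nonzero: \<open>2 * 3 ^ t\<close> is a sum of two powers of three
  only as \<open>3 ^ t + 3 ^ t\<close>, so its coefficient is \<open>z t\<close>.\<close>

lemma generic_parameter:
  fixes Z :: "(nat \<Rightarrow> real) set"
  assumes "finite Z"
  shows "\<exists>X>1. \<forall>z\<in>Z. \<forall>i<R. \<forall>j<R. \<forall>t\<in>{..<R} - {i, j}. i \<noteq> j \<longrightarrow> z t \<noteq> 0 \<longrightarrow>
      (\<Sum>t\<in>{..<R} - {i, j}. z t * ((X ^ 3 ^ t - X ^ 3 ^ i) * (X ^ 3 ^ t - X ^ 3 ^ j))) \<noteq> (0 :: real)"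
proof -
  define q :: "(nat \<Rightarrow> real) \<Rightarrow> nat \<Rightarrow> nat \<Rightarrow> real poly" where
    "q z i j = (\<Sum>t\<in>{..<R} - {i, j}. smult (z t)
       ((monom 1 (3 ^ t) - monom 1 (3 ^ i)) * (monom 1 (3 ^ t) - monom 1 (3 ^ j))))" for z i j
  have poly_q: "poly (q z i j) x =
      (\<Sum>t\<in>{..<R} - {i, j}. z t * ((x ^ 3 ^ t - x ^ 3 ^ i) * (x ^ 3 ^ t - x ^ 3 ^ j)))" for z i j x
    by (simp add: q_def poly_sum poly_monom)
  have q_nz: "q z i j \<noteq> 0" if "i \<noteq> j" "t \<in> {..<R} - {i, j}" "z t \<noteq> 0" for z i j t
  proof -
    have coeff: "coeff ((monom 1 (3 ^ s) - monom 1 (3 ^ i)) * (monom 1 (3 ^ s) - monom 1 (3 ^ j))) (2 * 3 ^ t)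
        = (if s = t then 1 else 0 :: real)" if "s \<in> {..<R} - {i, j}" for s
    proof -
      have "(monom 1 (3 ^ s) - monom 1 (3 ^ i)) * (monom 1 (3 ^ s) - monom 1 (3 ^ j)) =
          (monom 1 (3 ^ s + 3 ^ s) - monom 1 (3 ^ s + 3 ^ j) - monom 1 (3 ^ i + 3 ^ s) + monom 1 (3 ^ i + 3 ^ j) :: real poly)"
        by (simp only: left_diff_distrib right_diff_distrib mult_monom mult_1)
      moreover have "(3::nat) ^ s + 3 ^ s = 2 * 3 ^ t \<longleftrightarrow> s = t"
        using power3_add_power3_eq[of s s t] by auto
      moreover have "(3::nat) ^ s + 3 ^ j \<noteq> 2 * 3 ^ t" "(3::nat) ^ i + 3 ^ s \<noteq> 2 * 3 ^ t" "(3::nat) ^ i + 3 ^ j \<noteq> 2 * 3 ^ t"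
        using power3_add_power3_eq that \<open>i \<noteq> j\<close> by blast+
      ultimately show ?thesis by (simp only: coeff_add coeff_diff coeff_monom) simp
    qed
    have "coeff (q z i j) (2 * 3 ^ t) = (\<Sum>s\<in>{..<R} - {i, j}. if s = t then z s else 0)"
      unfolding q_def coeff_sum coeff_smult by (intro sum.cong refl) (simp add: coeff)
    also have "\<dots> = z t" using \<open>t \<in> {..<R} - {i, j}\<close> by simp
    finally show ?thesis using \<open>z t \<noteq> 0\<close> by auto
  qed
  \<comment> \<open>Finitely many nonzero polynomials have finitely many roots altogether, so some
    \<open>X > 1\<close> avoids them all. The bound also makes the powers \<open>X ^ 3 ^ t\<close>
    distinct.\<close>
  define Q where "Q = (\<lambda>(z, i, j). q z i j) ` (Z \<times> {..<R} \<times> {..<R}) - {0}"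
  have "finite (\<Union>p\<in>Q. {x. poly p x = 0})"
    using assms by (auto simp: Q_def intro!: poly_roots_finite)
  moreover have "infinite {1::real<..}" by (rule infinite_Ioi)
  ultimately have "infinite ({1<..} - (\<Union>p\<in>Q. {x. poly p x = 0}))" by (rule Diff_infinite_finite)
  from infinite_imp_nonempty[OF this] obtain X where "X \<in> {1<..} - (\<Union>p\<in>Q. {x. poly p x = 0})"
    unfolding ex_in_conv[symmetric] by (rule exE)
  then have X: "X > 1" "X \<notin> (\<Union>p\<in>Q. {x. poly p x = 0})" by simp_all
  show ?thesis
  proof (intro exI[of _ X] conjI X(1) ballI allI impI)
    fix z i j t assume *: "z \<in> Z" "i < R" "j < R" "t \<in> {..<R} - {i, j}" "i \<noteq> j" "z t \<noteq> 0"
    have "q z i j \<in> (\<lambda>(z, i, j). q z i j) ` (Z \<times> {..<R} \<times> {..<R})"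
      by (rule image_eqI[of _ _ "(z, i, j)"]) (use * in simp_all)
    then have "q z i j \<in> Q" using q_nz[of i j t z] * by (simp add: Q_def)
    then show "(\<Sum>t\<in>{..<R} - {i, j}. z t * ((X ^ 3 ^ t - X ^ 3 ^ i) * (X ^ 3 ^ t - X ^ 3 ^ j))) \<noteq> 0"
      using X(2) unfolding poly_q[symmetric] by blast
  qed
qed

definition moment_curve :: "real \<Rightarrow> real ^ 3" where
  "moment_curve x = vector [1, x, x\<^sup>2]"

text \<open>The image of the grid line under the linear map sending the \<open>t\<close>-th unit
  vector to \<open>moment_curve (X ^ 3 ^ t)\<close>, extended to an infinite line by letting
  \<open>s\<close> be real.\<close>

definition project_line :: "real \<Rightarrow> nat \<Rightarrow> nat \<times> (nat \<Rightarrow> nat) \<Rightarrow> (real ^ 3) set" where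
  "project_line X R u = range (\<lambda>s.
     (\<Sum>t\<in>{..<R} - {fst u}. real (snd u t) *\<^sub>R moment_curve (X ^ 3 ^ t)) + s *\<^sub>R moment_curve (X ^ 3 ^ fst u))"

lemma moment_curve_nonzero: "moment_curve x \<noteq> 0"
proof
  assume "moment_curve x = 0"
  then have "moment_curve x $ 1 = 0" by simp
  then show False by (simp add: moment_curve_def)
qed

lemma is_line_project_line: "is_line (project_line X R u)"
proof -
  let ?p = "\<Sum>t\<in>{..<R} - {fst u}. real (snd u t) *\<^sub>R moment_curve (X ^ 3 ^ t)"
  let ?d = "moment_curve (X ^ 3 ^ fst u)"
  have "project_line X R u = affine hull {?p, ?p + ?d}"
    by (simp add: project_line_def affine_hull_2_alt)
  then show ?thesis
    using moment_curve_nonzero by (simp add: is_line_def aff_dim_2 aff_dim_affine_hull affine_affine_hull)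
qed

text \<open>This functional vanishes on the projections of the coordinate directions \<open>i\<close> and \<open>j\<close>; its values
  on the other ones factorise, which replaces determinants in the genericity argument.\<close>

definition annihilator :: "real \<Rightarrow> nat \<Rightarrow> nat \<Rightarrow> real ^ 3 \<Rightarrow> real" where
  "annihilator X i j w = w $ 3 - (X ^ 3 ^ i + X ^ 3 ^ j) * w $ 2 + X ^ 3 ^ i * X ^ 3 ^ j * w $ 1"

lemma linear_annihilator: "linear (annihilator X i j)"
  by (rule linearI) (simp_all add: annihilator_def algebra_simps)

lemma annihilator_moment_curve:
  "annihilator X i j (moment_curve (X ^ 3 ^ t)) = (X ^ 3 ^ t - X ^ 3 ^ i) * (X ^ 3 ^ t - X ^ 3 ^ j)"
  by (simp add: annihilator_def moment_curve_def vector_3 power2_eq_square algebra_simps)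

text \<open>The terms with index \<open>i\<close> or \<open>j\<close> vanish, in particular the one
  for the direction of \<open>u\<close>, so the value is the same at all points of the line.\<close>

lemma annihilator_project_line:
  assumes "p \<in> project_line X R u" "fst u = i \<or> fst u = j"
  shows "annihilator X i j p =
    (\<Sum>t\<in>{..<R} - {i, j}. real (snd u t) * ((X ^ 3 ^ t - X ^ 3 ^ i) * (X ^ 3 ^ t - X ^ 3 ^ j)))"
proof -
  interpret linear "annihilator X i j" by (rule linear_annihilator)
  obtain s where p: "p = (\<Sum>t\<in>{..<R} - {fst u}. real (snd u t) *\<^sub>R moment_curve (X ^ 3 ^ t))
      + s *\<^sub>R moment_curve (X ^ 3 ^ fst u)"
    using assms(1) by (auto simp: project_line_def)
  have "annihilator X i j p =
      (\<Sum>t\<in>{..<R} - {fst u}. real (snd u t) * ((X ^ 3 ^ t - X ^ 3 ^ i) * (X ^ 3 ^ t - X ^ 3 ^ j)))"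
    using assms(2) unfolding p by (auto simp: add scale sum annihilator_moment_curve)
  also have "\<dots> = (\<Sum>t\<in>{..<R} - {i, j}. real (snd u t) * ((X ^ 3 ^ t - X ^ 3 ^ i) * (X ^ 3 ^ t - X ^ 3 ^ j)))"
    using assms(2) by (intro sum.mono_neutral_right) auto
  finally show ?thesis .
qed

lemma exists_third_index: "3 \<le> R \<Longrightarrow> \<exists>j<R. j \<noteq> a \<and> j \<noteq> b" for R a b :: nat
  by presburger

text \<open>At a common point of two projected lines an annihilator has one value with two
  expressions; by genericity the coordinates of the lines then agree outside \<open>i\<close> and
  \<open>j\<close>. Conversely, a crossing point in the grid is mapped to a common point.\<close>

lemma generic_projection:
  assumes R: "R \<ge> 3"
  shows "\<exists>f :: nat \<times> (nat \<Rightarrow> nat) \<Rightarrow> (real ^ 3) set.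
    (\<forall>u. is_line (f u)) \<and> inj_on f (grid_lines R) \<and>
    (\<forall>u\<in>grid_lines R. \<forall>v\<in>grid_lines R. u \<noteq> v \<longrightarrow> (f u \<inter> f v \<noteq> {} \<longleftrightarrow> crossing R u v))"
proof -
  define Z where "Z = (\<lambda>(u, v) t. real (snd u t) - real (snd v t)) ` (grid_lines R \<times> grid_lines R)"
  have "finite Z" by (simp add: Z_def finite_grid_lines)
  from generic_parameter[OF this, of R] obtain X :: real where X: "X > 1" and
    generic: "\<forall>z\<in>Z. \<forall>i<R. \<forall>j<R. \<forall>t\<in>{..<R} - {i, j}. i \<noteq> j \<longrightarrow> z t \<noteq> 0 \<longrightarrow>
      (\<Sum>t\<in>{..<R} - {i, j}. z t * ((X ^ 3 ^ t - X ^ 3 ^ i) * (X ^ 3 ^ t - X ^ 3 ^ j))) \<noteq> 0"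
    by (elim exE conjE)
  define f where "f = project_line X R"
  have less: "fst u < R" if "u \<in> grid_lines R" for u using that by (cases u) (simp add: grid_lines_def)
  have agree: "snd u t = snd v t"
    if uv: "u \<in> grid_lines R" "v \<in> grid_lines R" "p \<in> f u" "p \<in> f v"
      and ij: "i < R" "j < R" "i \<noteq> j" "fst u = i \<or> fst u = j" "fst v = i \<or> fst v = j"
      and t: "t \<in> {..<R} - {i, j}" for u v p i j t
  proof (rule ccontr)
    assume ne: "snd u t \<noteq> snd v t"
    have "annihilator X i j p - annihilator X i j p = (\<Sum>t\<in>{..<R} - {i, j}.
        (real (snd u t) - real (snd v t)) * ((X ^ 3 ^ t - X ^ 3 ^ i) * (X ^ 3 ^ t - X ^ 3 ^ j)))"
      using annihilator_project_line[of p X R u i j] annihilator_project_line[of p X R v i j] uv ij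
      by (simp add: f_def left_diff_distrib sum_subtractf)
    moreover have "(\<lambda>t. real (snd u t) - real (snd v t)) \<in> Z"
      unfolding Z_def by (rule image_eqI[of _ _ "(u, v)"]) (use uv in simp_all)
    ultimately show False using generic[rule_format, of "\<lambda>t. real (snd u t) - real (snd v t)" i j t] ij t ne by simp
  qed
  have inter: "crossing R u v" if uv: "u \<in> grid_lines R" "v \<in> grid_lines R" "u \<noteq> v" "p \<in> f u" "p \<in> f v" for u v p
  proof -
    have "fst u \<noteq> fst v"
    proof
      assume eq: "fst u = fst v"
      with uv grid_lines_eqI obtain t where t: "t < R" "t \<noteq> fst u" "snd u t \<noteq> snd v t" by blast
      \<comment> \<open>For parallel lines an auxiliary index \<open>j\<close> other than
        \<open>t\<close> completes the annihilator, so that the coordinate \<open>t\<close> where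
        they differ is tested.\<close>
      obtain j where j: "j < R" "j \<noteq> fst u" "j \<noteq> t" using R by (meson exists_third_index)
      then show False using agree[of u v p "fst u" j t] uv eq t less[of u] by auto
    qed
    then show ?thesis using agree[OF uv(1,2,4,5), of "fst u" "fst v"] uv less by (auto simp: crossing_def)
  qed
  have cross: "f u \<inter> f v \<noteq> {}" if uv: "u \<in> grid_lines R" "v \<in> grid_lines R" "crossing R u v" for u v
  proof -
    let ?a = "\<lambda>t. moment_curve (X ^ 3 ^ t)"
    let ?p = "(\<Sum>t\<in>{..<R} - {fst u}. real (snd u t) *\<^sub>R ?a t) + real (snd v (fst u)) *\<^sub>R ?a (fst u)"
    have ne: "fst u \<noteq> fst v" using uv by (simp add: crossing_def)
    have "(\<Sum>t\<in>{..<R} - {fst u}. real (snd u t) *\<^sub>R ?a t)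
        = real (snd u (fst v)) *\<^sub>R ?a (fst v) + (\<Sum>t\<in>{..<R} - {fst u} - {fst v}. real (snd u t) *\<^sub>R ?a t)"
      using ne less uv by (intro sum.remove) auto
    moreover have "(\<Sum>t\<in>{..<R} - {fst v}. real (snd v t) *\<^sub>R ?a t)
        = real (snd v (fst u)) *\<^sub>R ?a (fst u) + (\<Sum>t\<in>{..<R} - {fst v} - {fst u}. real (snd v t) *\<^sub>R ?a t)"
      using ne less uv by (intro sum.remove) auto
    moreover have "(\<Sum>t\<in>{..<R} - {fst u} - {fst v}. real (snd u t) *\<^sub>R ?a t)
        = (\<Sum>t\<in>{..<R} - {fst v} - {fst u}. real (snd v t) *\<^sub>R ?a t)"
      using uv(3) by (intro sum.cong) (auto simp: crossing_def)
    ultimately have "?p = (\<Sum>t\<in>{..<R} - {fst v}. real (snd v t) *\<^sub>R ?a t) + real (snd u (fst v)) *\<^sub>R ?a (fst v)"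
      by simp
    then have "?p \<in> f v" unfolding f_def project_line_def by (rule range_eqI)
    moreover have "?p \<in> f u" unfolding f_def project_line_def by (rule rangeI)
    ultimately show ?thesis by blast
  qed
  show ?thesis
  proof (intro exI[of _ f] conjI allI ballI impI)
    show "is_line (f u)" for u by (simp add: f_def is_line_project_line)
    show "f u \<inter> f v \<noteq> {} \<longleftrightarrow> crossing R u v" if "u \<in> grid_lines R" "v \<in> grid_lines R" "u \<noteq> v" for u v
      using inter cross that by blast
    show "inj_on f (grid_lines R)"
    proof (rule inj_onI, rule ccontr)
      fix u v assume uv: "u \<in> grid_lines R" "v \<in> grid_lines R" "f u = f v" "u \<noteq> v"
      define p where "p = (\<Sum>t\<in>{..<R} - {fst u}. real (snd u t) *\<^sub>R moment_curve (X ^ 3 ^ t))"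
      define d where "d = moment_curve (X ^ 3 ^ fst u)"
      have "p + 0 *\<^sub>R d \<in> f u" "p + 1 *\<^sub>R d \<in> f u"
        unfolding f_def project_line_def p_def d_def by blast+
      then have pq: "p \<in> f v" "p + d \<in> f v" "p \<in> f u" using uv(3) by auto
      have ne: "fst u \<noteq> fst v" using inter[OF uv(1,2,4) pq(3,1)] by (simp add: crossing_def)
      obtain j where j: "j < R" "j \<noteq> fst u" "j \<noteq> fst v" using R by (meson exists_third_index)
      interpret linear "annihilator X (fst v) j" by (rule linear_annihilator)
      \<comment> \<open>Both \<open>p\<close> and \<open>p + d\<close> lie on \<open>f v\<close>, so
        this annihilator must kill \<open>d\<close>, although \<open>fst u\<close> is neither of its
        indices.\<close>
      have "annihilator X (fst v) j (p + d) = annihilator X (fst v) j p"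
        using annihilator_project_line[of _ X R v "fst v" j] pq by (simp add: f_def)
      then have "annihilator X (fst v) j d = 0" by (simp add: add)
      then have "fst u = fst v \<or> fst u = j" using X by (simp add: d_def annihilator_moment_curve)
      then show False using ne j by simp
    qed
  qed
qed

subsection \<open>Girth and chromatic number\<close>

text \<open>The sampling lemma is applied with \<open>b = R * r\<close> and
  \<open>h = 2 * K * Q\<close>, so that \<open>h * b = R ^ R\<close> is exactly the number of grid
  lines.\<close>

lemma sparse_grid_lines:
  assumes g: "g > 0" and k: "k > 0"
  shows "\<exists>R S. R \<ge> 3 \<and> S \<subseteq> grid_lines R \<and>
    (\<forall>xs. set xs \<subseteq> S \<longrightarrow> 3 \<le> length xs \<longrightarrow> length xs < g \<longrightarrow> \<not> cycle_list (crossing R) xs) \<and>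
    (\<forall>c :: nat \<times> (nat \<Rightarrow> nat) \<Rightarrow> nat. c ` S \<subseteq> {..<k} \<longrightarrow> (\<exists>u\<in>S. \<exists>v\<in>S. crossing R u v \<and> c u = c v))"
proof -
  define K :: nat where "K = 2 ^ (4 * k + 4)"
  \<comment> \<open>The sample takes \<open>4 * k * h = d * Q\<close> out of
    \<open>Q * (R * R)\<close> lines, each crossing at most \<open>R * R\<close> others, so
    \<open>d\<close> bounds the expected degree.\<close>
  define d where "d = 8 * k * K"
  \<comment> \<open>Chosen after \<open>d\<close>, so that \<open>R\<close>, which is at least
    \<open>r\<close>, absorbs \<open>8 * g * l * d ^ (l - 1)\<close> for every cycle length
    \<open>l < g\<close>.\<close>
  define r where "r = 8 * g * g * d ^ g"
  define R where "R = 2 * K * r"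
  define Q where "Q = R ^ (R - 2)"
  have K: "K > 0" by (simp add: K_def)
  have d: "d > 0" using K k by (simp add: d_def)
  have r: "r \<ge> 8" using g d by (simp add: r_def)
  have rR: "r \<le> R" using K by (simp add: R_def)
  have R3: "R \<ge> 3" using r rR by simp
  have RR: "R ^ R = Q * (R * R)"
  proof -
    have "R ^ R = R ^ (R - 2 + 2)" using R3 by (subst le_add_diff_inverse2) simp_all
    also have "\<dots> = Q * (R * R)" by (simp only: Q_def power_add power2_eq_square)
    finally show ?thesis .
  qed
  have m: "4 * k * (2 * K * Q) = d * Q" by (simp add: d_def)
  have hb: "card (grid_lines R) \<le> (2 * K * Q) * (R * r)"
  proof -
    have "(2 * K * Q) * (R * r) = Q * ((2 * K * r) * R)" by (simp only: ac_simps)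
    also have "\<dots> = Q * (R * R)" by (simp only: R_def)
    finally have eq: "(2 * K * Q) * (R * r) = Q * (R * R)" .
    have "card (grid_lines R) = Q * (R * R)" using R3 card_grid_lines[of R] RR by simp
    then show ?thesis unfolding eq by (rule eq_refl)
  qed
  have cyc: "8 * g * (4 * k * (2 * K * Q)) ^ l * card {xs. length xs = l \<and> set xs \<subseteq> grid_lines R \<and> cycle_list (crossing R) xs}
      \<le> 4 * k * (2 * K * Q) * card (grid_lines R) ^ l" if l: "3 \<le> l" "l < g" for l
  proof -
    obtain j where j: "l = j + 3" using l by (metis le_add_diff_inverse2)
    let ?C = "card {xs. length xs = l \<and> set xs \<subseteq> grid_lines R \<and> cycle_list (crossing R) xs}"
    define N where "N = R ^ R"
    have N: "N = Q * (R * R)" by (simp add: N_def RR)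
    have "8 * g * (d * Q) ^ l * ?C \<le> 8 * g * (d * Q) ^ (j + 3) * (N * (R * R) ^ (j + 1) * ((j + 3) * R))"
      using card_grid_cycles[of R j] R3 unfolding N_def j by (intro mult_le_mono2) simp
    also have "\<dots> = (8 * g * (j + 3) * d ^ (j + 2)) * (d * Q ^ (j + 3) * (N * (R * R) ^ (j + 1) * R))"
    proof -
      have "d ^ (j + 3) = d * d ^ (j + 2)" by (simp add: numeral_3_eq_3)
      then show ?thesis by (simp only: power_mult_distrib ac_simps)
    qed
    also have "\<dots> \<le> R * (d * Q ^ (j + 3) * (N * (R * R) ^ (j + 1) * R))"
    proof (rule mult_le_mono1)
      have "8 * g * (j + 3) * d ^ (j + 2) \<le> 8 * g * g * d ^ g"
        using l d by (intro mult_le_mono mult_le_mono2 power_increasing) (auto simp: j)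
      then show "8 * g * (j + 3) * d ^ (j + 2) \<le> R" using rR by (simp only: r_def)
    qed
    also have "\<dots> = d * Q * N ^ (j + 3)"
      unfolding N by (simp add: power_mult_distrib eval_nat_numeral ac_simps)
    finally show ?thesis using R3 by (simp add: m card_grid_lines N_def j)
  qed
  have low: "card {v \<in> A. card {w \<in> A. crossing R v w} < R * r} * 2 ^ (4 * k + 4) \<le> card (grid_lines R)"
    if "A \<subseteq> grid_lines R" for A
    using card_low_crossing[OF that, of K r] K r by (simp add: R_def K_def)
  have ne: "grid_lines R \<noteq> {}" using card_grid_lines[of R] R3 by auto
  have pos: "R * r > 0" "2 * K * Q > 0" using R3 r K by (simp_all add: Q_def)
  from sparse_sampling[OF finite_grid_lines ne pos k g low hb cyc] R3
  show ?thesis by (intro exI[of _ R]) simp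
qed

section \<open>From digraph cycles to vertex lists\<close>

lemma cas_pair_successively:
  assumes "pre_digraph.cas (with_proj G) u p v" "set p \<subseteq> parcs G"
  shows "successively (\<lambda>x y. (x, y) \<in> parcs G) (u # map snd p) \<and> last (u # map snd p) = v"
  using assms
proof (induction p arbitrary: u)
  case Nil
  then show ?case by (simp add: pre_digraph.cas.simps)
next
  case (Cons e p)
  have e: "e = (u, snd e)" using Cons.prems(1) by (cases e) (simp add: pre_digraph.cas.simps)
  have "pre_digraph.cas (with_proj G) (snd e) p v" using Cons.prems(1) by (simp add: pre_digraph.cas.simps)
  with Cons.IH[of "snd e"] Cons.prems(2)
  have IH: "successively (\<lambda>x y. (x, y) \<in> parcs G) (snd e # map snd p)" "last (snd e # map snd p) = v" by auto
  have "(u, snd e) \<in> parcs G" using Cons.prems(2) e by (metis list.set_intros(1) subsetD)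
  then show ?case using IH by simp
qed

text \<open>Taking the heads of the arcs drops the start vertex, which returns as the last head; so
  the list has the length of \<open>p\<close> and no repetition.\<close>

lemma cycle_imp_cycle_list:
  assumes "pre_digraph.cycle (with_proj G) p"
  shows "cycle_list (\<lambda>x y. (x, y) \<in> parcs G) (map snd p)"
proof -
  obtain u where u: "pre_digraph.awalk (with_proj G) u p u"
    "distinct (tl (pre_digraph.awalk_verts (with_proj G) u p))" "p \<noteq> []"
    using assms by (auto simp: pre_digraph.cycle_def)
  have "distinct (map snd p)"
    using u pre_digraph.awalk_verts_conv'[of "with_proj G" u p u] by (simp add: pre_digraph.awalk_def)
  moreover have "successively (\<lambda>x y. (x, y) \<in> parcs G) (u # map snd p)" "last (u # map snd p) = u"
    using cas_pair_successively[of G u p u] u(1) by (auto simp: pre_digraph.awalk_def)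
  ultimately show ?thesis using u(3) by (cases p) (auto simp: cycle_list_def)
qed

theorem theorem2:
  fixes g k :: nat
  assumes "g \<ge> 3" and "k \<ge> 1"
  shows "\<exists>\<S> :: (real ^ 3) set set.
           finite \<S> \<and> (\<forall>L \<in> \<S>. is_line L) \<and>
           girth (intersection_graph \<S>) \<ge> enat g \<and>
           chromatic_number (intersection_graph \<S>) \<ge> enat k"
proof -
  have "g > 0" "k > 0" using assms by simp_all
  from sparse_grid_lines[OF this] obtain R S where R: "R \<ge> 3" and S: "S \<subseteq> grid_lines R"
    and girth: "\<forall>xs. set xs \<subseteq> S \<longrightarrow> 3 \<le> length xs \<longrightarrow> length xs < g \<longrightarrow> \<not> cycle_list (crossing R) xs"
    and chrom: "\<forall>c :: nat \<times> (nat \<Rightarrow> nat) \<Rightarrow> nat. c ` S \<subseteq> {..<k} \<longrightarrow> (\<exists>u\<in>S. \<exists>v\<in>S. crossing R u v \<and> c u = c v)"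
    by (elim exE conjE)
  from generic_projection[OF R] obtain f :: "nat \<times> (nat \<Rightarrow> nat) \<Rightarrow> (real ^ 3) set" where line: "\<forall>u. is_line (f u)"
    and inj: "inj_on f (grid_lines R)"
    and inter: "\<forall>u\<in>grid_lines R. \<forall>v\<in>grid_lines R. u \<noteq> v \<longrightarrow> (f u \<inter> f v \<noteq> {} \<longleftrightarrow> crossing R u v)"
    by (elim exE conjE)
  define G where "G = intersection_graph (f ` S)"
  have arc: "(f u, f v) \<in> parcs G \<longleftrightarrow> crossing R u v" if uv: "u \<in> S" "v \<in> S" for u v
  proof -
    have "f u = f v \<longleftrightarrow> u = v" using inj uv S by (meson inj_on_eq_iff subsetD)
    moreover have "\<not> crossing R u u" by (simp add: crossing_def)
    ultimately show ?thesis using inter uv S by (auto simp: G_def intersection_graph_def)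
  qed
  have "enat g \<le> girth G"
    unfolding girth_def
  proof (rule INF_greatest)
    fix p assume p: "p \<in> {p. pre_digraph.cycle (with_proj G) p \<and> 3 \<le> length p}"
    show "enat g \<le> enat (length p)"
    proof (rule ccontr)
      assume "\<not> enat g \<le> enat (length p)"
      then have short: "length p < g" by simp
      have cyc: "cycle_list (\<lambda>x y. (x, y) \<in> parcs G) (map snd p)"
        using p by (intro cycle_imp_cycle_list) simp
      have "set p \<subseteq> parcs G" using p by (auto simp: pre_digraph.cycle_def pre_digraph.awalk_def)
      then have "set (map snd p) \<subseteq> f ` S" by (auto simp: G_def intersection_graph_def)
      \<comment> \<open>A short cycle of projected lines is lifted to a list of grid lines in
        \<open>S\<close>, which is shown to be a cycle for \<open>crossing R\<close>.\<close>
      then have "map snd p \<in> map f ` lists S" by (auto simp: lists_image[symmetric])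
      then obtain xs where xs: "map snd p = map f xs" "set xs \<subseteq> S" by auto
      have len: "length xs = length p" using xs(1) by (metis length_map)
      then have ne: "xs \<noteq> []" using p by auto
      have lifted: "cycle_list (\<lambda>x y. (f x, f y) \<in> parcs G) xs"
        using cyc ne unfolding xs(1) by (simp add: cycle_list_def successively_map distinct_map hd_map last_map)
      have adj: "crossing R x y" if "x \<in> set xs" "y \<in> set xs" "(f x, f y) \<in> parcs G" for x y
        using that xs(2) arc[of x y] by (meson subsetD)
      have "successively (crossing R) xs"
        by (rule successively_mono[OF _ adj]) (use lifted in \<open>simp_all add: cycle_list_def\<close>)
      moreover have "crossing R (last xs) (hd xs)"
        using lifted ne by (intro adj) (simp_all add: cycle_list_def)
      ultimately have "cycle_list (crossing R) xs" using lifted by (simp add: cycle_list_def)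
      then show False using girth xs(2) len p short by simp
    qed
  qed
  moreover have "enat k \<le> chromatic_number G"
    unfolding chromatic_number_def
  proof (rule INF_greatest)
    fix n assume "n \<in> {n. \<exists>c. proper_coloring G n c}"
    then obtain c where c: "proper_coloring G n c" by blast
    show "enat k \<le> enat n"
    proof (rule ccontr)
      assume "\<not> enat k \<le> enat n"
      \<comment> \<open>A colouring of \<open>G\<close> with fewer than \<open>k\<close> colours is
        pulled back along \<open>f\<close> to the grid lines.\<close>
      then have "(c \<circ> f) ` S \<subseteq> {..<k}"
        using c by (force simp: proper_coloring_def G_def intersection_graph_def)
      then obtain u v where uv: "u \<in> S" "v \<in> S" "crossing R u v" "(c \<circ> f) u = (c \<circ> f) v"
        using chrom by meson
      then have "(f u, f v) \<in> parcs G" using arc by simp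
      then show False using c uv(4) by (auto simp: proper_coloring_def)
    qed
  qed
  moreover have "finite (f ` S)" using S finite_grid_lines finite_subset by blast
  moreover have "\<forall>L\<in>f ` S. is_line L" using line by blast
  ultimately show ?thesis unfolding G_def by blast
qed

end
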